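(* Let $V_{\mathbb{R}}=\mathbb{R}^{2d}$ and let $0<p\le2$. Then the locally convex topology on $\mathrm{S}^\bullet(V_{\mathbb{R}})\otimes\mathbb{C}$ induced by the seminorms $\|\cdot\|_{p,s}$ for $s>0$ coincides with the topology of $\mathrm{S}^\bullet_R(V_{\mathbb{R}})\otimes\mathbb{C}$ if we set $R=\frac1p$.
   Context: $V_{\mathbb{R}}=\mathbb{R}^{2d}$ (purely even), and $\mathrm{S}^\bullet(V_{\mathbb{R}})\otimes\mathbb{C}=\mathrm{S}^\bullet(V_{\mathbb{R}}\otimes\mathbb{C})$ is the complexified symmetric algebra, where $\mathrm{S}^n(V)\subseteq V^{\otimes n}$ is the space of symmetric tensors and the product is the symmetrized tensor product. It is identified with the algebra of complex polynomials on $\mathbb{C}^{2d}$ by identifying the canonical basis vectors of $\mathbb{R}^{2d}$ with the coordinate functions $x_1,\ldots,x_{2d}$ on $\mathbb{C}^{2d}$. For a polynomial $a$ and $s>0$ set $$\|a\|_{p,s}=\sup_{x\in\mathbb{C}^{2d}}|a(x)|\,\mathrm{e}^{-s|x|^p},$$ where $|x|$ is the euclidean norm of $x\in\mathbb{C}^{2d}$. The topology of $\mathrm{S}^\bullet_R(V_{\mathbb{R}})\otimes\mathbb{C}$ is the locally convex topology on $\mathrm{S}^\bullet(V)$, $V=V_{\mathbb{R}}\otimes\mathbb{C}$, defined by all seminorms $q_R(a)=\sum_{n\ge0}q^n(a_n)\,n!^R$, where $q$ is a seminorm on $V$, $q^n$ is the projective tensor seminorm $q\otimes\cdots\otimes q$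 on $V^{\otimes n}$ ($q^0=|\cdot|$), and $a=\sum_na_n$ with $a_n\in \mathrm{S}^n(V)$. *)

theory Defs
  imports "HOL-Analysis.Analysis" "HOL-Library.Poly_Mapping" "HOL-Combinatorics.Permutations"
begin

section \<open>Locally convex topologies defined by seminorms\<close>

definition complex_seminorm :: "(complex^'n \<Rightarrow> real) \<Rightarrow> bool" where
  "complex_seminorm q \<longleftrightarrow>
     (\<forall>x y. q (x + y) \<le> q x + q y) \<and> (\<forall>c x. q (c *s x) = cmod c * q x)"

text \<open>The carrier \<open>S\<close> is the vector space on which the family \<open>P\<close> of seminorms lives; the open balls
  of all the seminorms form a subbasis.\<close>

definition seminorm_topology :: "'a::ab_group_add set \<Rightarrow> ('a \<Rightarrow> real) set \<Rightarrow> 'a topology" where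
  "seminorm_topology S P =
     topology_generated_by {{y \<in> S. q (y - x) < r} | q x r. q \<in> P \<and> x \<in> S \<and> r > 0}"


section \<open>The tensor algebra and the symmetric algebra\<close>

text \<open>The tensor algebra of \<open>V = complex^'n\<close> is realised in the basis of words: a word \<open>[i\<^sub>1, \<dots>, i\<^sub>k]\<close>
  stands for the tensor product of the canonical basis vectors with indices \<open>i\<^sub>1, \<dots>, i\<^sub>k\<close>, and a tensor
  is the finitely supported family of its coefficients.\<close>

type_synonym 'n tensor = "'n list \<Rightarrow>\<^sub>0 complex"

definition tensor_power :: "nat \<Rightarrow> 'n tensor set" where
  "tensor_power n = {t. \<forall>w \<in> Poly_Mapping.keys t. length w = n}"

definition symmetric_power :: "nat \<Rightarrow> 'n tensor set" where
  "symmetric_power n = {t \<in> tensor_power n. \<forall>\<sigma> w. \<sigma> permutes {..<n} \<longrightarrow> length w = n \<longrightarrow>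
     Poly_Mapping.lookup t (permute_list \<sigma> w) = Poly_Mapping.lookup t w}"

lift_definition component :: "nat \<Rightarrow> 'n tensor \<Rightarrow> 'n tensor" is
  "\<lambda>n a w. if length w = n then a w else 0"
  by (erule rev_finite_subset) auto

definition symmetric_algebra :: "'n tensor set" where
  "symmetric_algebra = {a. \<forall>n. component n a \<in> symmetric_power n}"

text \<open>The tensor product \<open>v\<^sub>1 \<otimes> \<dots> \<otimes> v\<^sub>k\<close> of a list of vectors.\<close>

lift_definition elementary_tensor :: "(complex^'n) list \<Rightarrow> 'n::finite tensor" is
  "\<lambda>vs w. if length w = length vs then (\<Prod>i<length vs. vs ! i $ (w ! i)) else 0"
proof -
  fix vs :: "(complex^'n) list"
  have "finite {w :: 'n list. set w \<subseteq> UNIV \<and> length w = length vs}"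
    by (rule finite_lists_length_eq) simp
  then show "finite {w. (if length w = length vs then \<Prod>i<length vs. vs ! i $ (w ! i) else 0) \<noteq> 0}"
    by (rule rev_finite_subset) auto
qed

lift_definition tensor_mult :: "'n tensor \<Rightarrow> 'n tensor \<Rightarrow> 'n tensor" is
  "\<lambda>a b w. \<Sum>k\<le>length w. a (take k w) * b (drop k w)"
proof -
  fix a b :: "'n list \<Rightarrow> complex"
  assume fin: "finite {w. a w \<noteq> 0}" "finite {w. b w \<noteq> 0}"
  have "{w. (\<Sum>k\<le>length w. a (take k w) * b (drop k w)) \<noteq> 0}
      \<subseteq> (\<lambda>(u, v). u @ v) ` ({w. a w \<noteq> 0} \<times> {w. b w \<noteq> 0})"
  proof
    fix w assume "w \<in> {w. (\<Sum>k\<le>length w. a (take k w) * b (drop k w)) \<noteq> 0}"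
    then obtain k where "a (take k w) * b (drop k w) \<noteq> 0"
      by (metis (mono_tags, lifting) mem_Collect_eq sum.neutral)
    then show "w \<in> (\<lambda>(u, v). u @ v) ` ({w. a w \<noteq> 0} \<times> {w. b w \<noteq> 0})"
      by (intro image_eqI[of _ _ "(take k w, drop k w)"]) auto
  qed
  then show "finite {w. (\<Sum>k\<le>length w. a (take k w) * b (drop k w)) \<noteq> 0}"
    by (rule finite_subset) (use fin in auto)
qed

lift_definition symmetrize :: "'n::finite tensor \<Rightarrow> 'n tensor" is
  "\<lambda>a w. (\<Sum>\<sigma> | \<sigma> permutes {..<length w}. a (permute_list \<sigma> w)) / fact (length w)"
proof -
  fix a :: "'n list \<Rightarrow> complex"
  assume fin: "finite {w. a w \<noteq> 0}"
  define N where "N = Max (insert 0 (length ` {w. a w \<noteq> 0}))"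
  have N: "length w \<le> N" if "a w \<noteq> 0" for w
    unfolding N_def using fin that by (intro Max_ge) auto
  have "{w. (\<Sum>\<sigma> | \<sigma> permutes {..<length w}. a (permute_list \<sigma> w)) / fact (length w) \<noteq> 0}
      \<subseteq> {w. set w \<subseteq> UNIV \<and> length w \<le> N}"
  proof safe
    fix w :: "'n list"
    assume "(\<Sum>\<sigma> | \<sigma> permutes {..<length w}. a (permute_list \<sigma> w)) / fact (length w) \<noteq> 0"
    then obtain \<sigma> where "a (permute_list \<sigma> w) \<noteq> 0"
      by (metis (mono_tags, lifting) div_0 sum.neutral)
    from N[OF this] show "length w \<le> N" by simp
  qed auto
  then show "finite {w. (\<Sum>\<sigma> | \<sigma> permutes {..<length w}. a (permute_list \<sigma> w)) / fact (length w) \<noteq> 0}"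
    by (rule finite_subset) (rule finite_lists_length_le, simp)
qed

definition symmetric_mult :: "'n::finite tensor \<Rightarrow> 'n tensor \<Rightarrow> 'n tensor" where
  "symmetric_mult a b = symmetrize (tensor_mult a b)"


section \<open>The identification with polynomials\<close>

text \<open>The canonical basis vector with index \<open>i\<close> becomes the coordinate function \<open>x\<^sub>i\<close>, so that a word
  becomes a monomial.  The lemmas below confirm that this is multiplicative for the symmetrized
  tensor product.\<close>

definition polynomial_of :: "'n tensor \<Rightarrow> complex^'n \<Rightarrow> complex" where
  "polynomial_of a x = (\<Sum>w\<in>Poly_Mapping.keys a. Poly_Mapping.lookup a w * (\<Prod>i\<leftarrow>w. x $ i))"

lemma polynomial_of_superset:
  assumes "finite W" "Poly_Mapping.keys a \<subseteq> W"
  shows "polynomial_of a x = (\<Sum>w\<in>W. Poly_Mapping.lookup a w * (\<Prod>i\<leftarrow>w. x $ i))"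
  unfolding polynomial_of_def
  by (rule sum.mono_neutral_left) (use assms in \<open>auto simp: in_keys_iff\<close>)

lemma polynomial_of_add: "polynomial_of (a + b) x = polynomial_of a x + polynomial_of b x"
proof -
  let ?W = "Poly_Mapping.keys a \<union> Poly_Mapping.keys b"
  have "Poly_Mapping.keys (a + b) \<subseteq> ?W" by (rule keys_add)
  then show ?thesis
    by (subst (1 2 3) polynomial_of_superset[of ?W])
       (auto simp: lookup_add distrib_right sum.distrib)
qed

lemma polynomial_of_one: "polynomial_of (elementary_tensor []) x = 1"
  by (subst polynomial_of_superset[of "{[]}"])
     (auto simp: in_keys_iff elementary_tensor.rep_eq split: if_splits)

lemma polynomial_of_basis: "polynomial_of (elementary_tensor [axis i 1]) x = x $ i"
  by (subst polynomial_of_superset[of "{[i]}"])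
     (auto simp: in_keys_iff elementary_tensor.rep_eq axis_def length_Suc_conv split: if_splits)

lemma polynomial_of_tensor_mult:
  "polynomial_of (tensor_mult a b) x = polynomial_of a x * polynomial_of b x"
proof -
  let ?A = "Poly_Mapping.keys a" and ?B = "Poly_Mapping.keys b"
  let ?W = "(\<lambda>(u, v). u @ v) ` (?A \<times> ?B)"
  let ?m = "\<lambda>w. \<Prod>i\<leftarrow>w. x $ i"
  let ?f = "\<lambda>(w, k). Poly_Mapping.lookup a (take k w) * Poly_Mapping.lookup b (drop k w) * ?m w"
  let ?S = "{(w, k). w \<in> ?W \<and> k \<le> length w}"
  let ?T = "{(w, k). k \<le> length w \<and> take k w \<in> ?A \<and> drop k w \<in> ?B}"
  have S: "?S = Sigma ?W (\<lambda>w. {..length w})" by auto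
  have W: "w \<in> ?W" if "take k w \<in> ?A" "drop k w \<in> ?B" for w k
    by (rule image_eqI[of _ _ "(take k w, drop k w)"]) (use that in auto)
  have sub: "?T \<subseteq> ?S"
  proof
    fix z assume "z \<in> ?T"
    then obtain w k where "z = (w, k)" "k \<le> length w" "take k w \<in> ?A" "drop k w \<in> ?B" by auto
    with W show "z \<in> ?S" by (simp del: image_iff)
  qed
  have keys: "Poly_Mapping.keys (tensor_mult a b) \<subseteq> ?W"
  proof
    fix w assume "w \<in> Poly_Mapping.keys (tensor_mult a b)"
    then obtain k where "Poly_Mapping.lookup a (take k w) * Poly_Mapping.lookup b (drop k w) \<noteq> 0"
      unfolding in_keys_iff tensor_mult.rep_eq by (metis (mono_tags, lifting) sum.neutral)
    then show "w \<in> ?W"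
      by (intro image_eqI[of _ _ "(take k w, drop k w)"]) (auto simp: in_keys_iff)
  qed
  have "polynomial_of (tensor_mult a b) x = (\<Sum>w\<in>?W. \<Sum>k\<le>length w. ?f (w, k))"
    by (subst polynomial_of_superset[OF _ keys]) (simp_all add: tensor_mult.rep_eq sum_distrib_right)
  also have "\<dots> = sum ?f ?S"
    unfolding S by (subst sum.Sigma) auto
  also have "\<dots> = sum ?f ?T"
    by (rule sum.mono_neutral_right[OF _ sub]) (auto simp: S in_keys_iff)
  also have "\<dots> = (\<Sum>(u, v)\<in>?A \<times> ?B. (Poly_Mapping.lookup a u * ?m u) * (Poly_Mapping.lookup b v * ?m v))"
  proof (rule sum.reindex_bij_witness[of _ "\<lambda>(u, v). (u @ v, length u)" "\<lambda>(w, k). (take k w, drop k w)"])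
    fix z assume "z \<in> ?T"
    then obtain w k where z: "z = (w, k)" "k \<le> length w" by auto
    have "?m w = ?m (take k w) * ?m (drop k w)"
      by (metis append_take_drop_id map_append prod_list.append)
    then show "(case case z of (w, k) \<Rightarrow> (take k w, drop k w) of
        (u, v) \<Rightarrow> (Poly_Mapping.lookup a u * ?m u) * (Poly_Mapping.lookup b v * ?m v)) = ?f z"
      by (simp add: z)
  qed auto
  also have "\<dots> = polynomial_of a x * polynomial_of b x"
    by (simp add: polynomial_of_def sum_product sum.cartesian_product)
  finally show ?thesis .
qed

lemma polynomial_of_symmetrize: "polynomial_of (symmetrize a) x = polynomial_of a x"
proof -
  let ?m = "\<lambda>w. \<Prod>i\<leftarrow>w. x $ i"
  let ?P = "\<lambda>n::nat. {\<sigma>. \<sigma> permutes {..<n}}"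
  define K where "K = Poly_Mapping.keys a \<union> Poly_Mapping.keys (symmetrize a)"
  define N where "N = Max (insert 0 (length ` K))"
  define L where "L = (\<lambda>n. {w :: 'a list. length w = n})"
  have finK: "finite K" by (simp add: K_def)
  have finL: "finite (L n)" for n
    using finite_lists_length_eq[of "UNIV :: 'a set" n] by (simp add: L_def)
  have sub: "K \<subseteq> (\<Union>n\<le>N. L n)"
    using finK by (auto simp: L_def N_def)
  have split: "polynomial_of c x = (\<Sum>n\<le>N. \<Sum>w\<in>L n. Poly_Mapping.lookup c w * ?m w)"
    if "Poly_Mapping.keys c \<subseteq> K" for c
  proof -
    have "polynomial_of c x = (\<Sum>w\<in>(\<Union>n\<le>N. L n). Poly_Mapping.lookup c w * ?m w)"
      by (rule polynomial_of_superset) (use that sub finL in auto)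
    also have "\<dots> = (\<Sum>n\<le>N. \<Sum>w\<in>L n. Poly_Mapping.lookup c w * ?m w)"
      by (rule sum.UNION_disjoint) (use finL in \<open>auto simp: L_def\<close>)
    finally show ?thesis .
  qed
  have perm: "(\<Sum>w\<in>L n. Poly_Mapping.lookup a (permute_list \<sigma> w) * ?m w)
      = (\<Sum>w\<in>L n. Poly_Mapping.lookup a w * ?m w)" if "\<sigma> permutes {..<n}" for n \<sigma>
  proof (rule sum.reindex_bij_witness[of _ "permute_list (inv \<sigma>)" "permute_list \<sigma>"])
    fix w :: "'a list" assume "w \<in> L n"
    then have len: "length w = n" by (simp add: L_def)
    show "permute_list (inv \<sigma>) (permute_list \<sigma> w) = w"
      using permute_list_compose[of "inv \<sigma>" w \<sigma>] permutes_inv[OF that] that len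
      by (simp add: permutes_inv_o)
    show "permute_list \<sigma> (permute_list (inv \<sigma>) w) = w"
      using permute_list_compose[of \<sigma> w "inv \<sigma>"] that len
      by (simp add: permutes_inv_o)
    have "mset (permute_list \<sigma> w) = mset w"
      using that len by simp
    then have "?m (permute_list \<sigma> w) = ?m w"
      by (metis mset_map prod_mset_prod_list)
    then show "Poly_Mapping.lookup a (permute_list \<sigma> w) * ?m (permute_list \<sigma> w)
        = Poly_Mapping.lookup a (permute_list \<sigma> w) * ?m w" by simp
  qed (auto simp: L_def)
  have "(\<Sum>w\<in>L n. Poly_Mapping.lookup (symmetrize a) w * ?m w)
      = (\<Sum>w\<in>L n. Poly_Mapping.lookup a w * ?m w)" for n
  proof -
    have "(\<Sum>w\<in>L n. Poly_Mapping.lookup (symmetrize a) w * ?m w)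
        = (\<Sum>w\<in>L n. \<Sum>\<sigma>\<in>?P n. Poly_Mapping.lookup a (permute_list \<sigma> w) * ?m w) / fact n"
      by (simp add: symmetrize.rep_eq L_def sum_divide_distrib sum_distrib_right)
    also have "\<dots> = (\<Sum>\<sigma>\<in>?P n. \<Sum>w\<in>L n. Poly_Mapping.lookup a (permute_list \<sigma> w) * ?m w) / fact n"
      by (subst sum.swap) simp
    also have "\<dots> = (\<Sum>\<sigma>\<in>?P n. \<Sum>w\<in>L n. Poly_Mapping.lookup a w * ?m w) / fact n"
      by (subst sum.cong[OF refl perm]) auto
    also have "\<dots> = (\<Sum>w\<in>L n. Poly_Mapping.lookup a w * ?m w)"
      by (simp add: card_permutations[OF refl])
    finally show ?thesis .
  qed
  then show ?thesis
    by (simp add: split K_def)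
qed

lemma polynomial_of_symmetric_mult:
  "polynomial_of (symmetric_mult a b) x = polynomial_of a x * polynomial_of b x"
  by (simp add: symmetric_mult_def polynomial_of_symmetrize polynomial_of_tensor_mult)


section \<open>The two families of seminorms\<close>

text \<open>\<open>norm\<close> on \<open>complex^'n\<close> is the euclidean norm; for \<open>s > 0\<close> and \<open>p > 0\<close> the supremum is finite, since
  a polynomial is dominated by the exponential.\<close>

definition growth_norm :: "real \<Rightarrow> real \<Rightarrow> 'n::finite tensor \<Rightarrow> real" where
  "growth_norm p s a = (SUP x. cmod (polynomial_of a x) * exp (- s * norm x powr p))"

text \<open>For \<open>n = 0\<close> the tensor power is the field of scalars (the coefficient of the empty word).\<close>

definition projective_seminorm ::
    "(complex^'n \<Rightarrow> real) \<Rightarrow> nat \<Rightarrow> 'n::finite tensor \<Rightarrow> real" where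
  "projective_seminorm q n t =
     (if n = 0 then cmod (Poly_Mapping.lookup t [])
      else Inf {(\<Sum>vs\<leftarrow>vss. \<Prod>v\<leftarrow>vs. q v) | vss.
             (\<forall>vs\<in>set vss. length vs = n) \<and> t = (\<Sum>vs\<leftarrow>vss. elementary_tensor vs)})"

text \<open>Only finitely many terms of the series are nonzero.\<close>

definition weighted_seminorm ::
    "real \<Rightarrow> (complex^'n \<Rightarrow> real) \<Rightarrow> 'n::finite tensor \<Rightarrow> real" where
  "weighted_seminorm R q a = suminf (\<lambda>n. projective_seminorm q n (component n a) * fact n powr R)"

end

theory Submission
  imports Defs
begin

text \<open>
  Two families of seminorms define the same topology as soon as every member of either family is
  bounded by a multiple of a member of the other.  So everything rests on two inequalities, one
  for each direction; with \<open>p\<close> fixed, both come from comparing \<open>n!\<^sup>1\<^sup>/\<^sup>p\<close> with the maximum of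
  \<open>r\<^sup>n exp (- s r\<^sup>p)\<close> over \<open>r \<ge> 0\<close>, which is \<open>(n / (e p s))\<^sup>n\<^sup>/\<^sup>p\<close>.

  Growth is bounded by the weighted seminorms (\<open>growth_norm_le_weighted\<close>).  A decomposition of
  \<open>a\<^sub>n\<close> into elementary tensors and the Cauchy-Schwarz inequality for each factor show that
  \<open>|a\<^sub>n(x)|\<close> is at most \<open>(|x| / K)\<^sup>n\<close> times the projective seminorm of \<open>a\<^sub>n\<close> belonging to
  \<open>K |\<cdot>|\<close>.  The factor \<open>exp (- s |x|\<^sup>p)\<close> turns \<open>(|x| / K)\<^sup>n\<close> into something at most \<open>n!\<^sup>1\<^sup>/\<^sup>p\<close>
  when \<open>K\<^sup>p = 1 / (p s)\<close>, because \<open>y\<^sup>n / n! \<le> exp y\<close> for \<open>y = p s |x|\<^sup>p\<close>.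

  The weighted seminorms are bounded by growth (\<open>weighted_seminorm_le_growth\<close>).  On the torus
  \<open>|x\<^sub>i| = \<rho>\<close> the polynomial is at most \<open>exp (S \<rho>\<^sup>p)\<close> times its growth norm, with \<open>S\<close> proportional
  to \<open>s\<close>, and Cauchy's estimate (\<open>cauchy_estimate\<close>) bounds each coefficient of degree \<open>n\<close> by
  \<open>\<rho>\<^sup>-\<^sup>n\<close> times that.  In degree \<open>n\<close> there are \<open>m\<^sup>n\<close> words over \<open>m\<close> letters, so the projective
  seminorm of \<open>a\<^sub>n\<close> costs only a further geometric factor.  The choice \<open>\<rho>\<^sup>p = n / (p S)\<close> is optimal,
  and since \<open>n! \<le> n\<^sup>n\<close>, the \<open>n\<close>-th term of the weighted seminorm is at most \<open>(const \<cdot> s\<^sup>1\<^sup>/\<^sup>p)\<^sup>n\<close>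
  times the growth norm.  For small \<open>s\<close> this is a convergent geometric series.

  Symmetry of the tensors is what makes the second inequality possible: the polynomial only
  determines the sum of the coefficients over all rearrangements of a word, and for a symmetric
  tensor these coefficients are all equal.
\<close>


section \<open>Comparing topologies defined by seminorms\<close>

text \<open>A ball of \<open>q \<in> P\<close> is a neighbourhood of each of its points \<open>y\<close> in the topology of \<open>Q\<close>: by the
  triangle inequality for \<open>q\<close> it contains a ball around \<open>y\<close> of a seminorm in \<open>Q\<close> that dominates
  \<open>q\<close>.  Domination is only available on the subspace \<open>S\<close>, hence the closure under differences.\<close>

lemma openin_seminorm_topology_mono:
  assumes minus: "\<And>x y. x \<in> S \<Longrightarrow> y \<in> S \<Longrightarrow> x - y \<in> S"
    and subadd: "\<And>q x y. q \<in> P \<Longrightarrow> q (x + y) \<le> q x + q y"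
    and zero: "\<And>q. q \<in> Q \<Longrightarrow> q 0 = 0"
    and dominated: "\<And>q. q \<in> P \<Longrightarrow> \<exists>q'\<in>Q. \<exists>C>0. \<forall>x\<in>S. q x \<le> C * q' x"
    and U: "openin (seminorm_topology S P) U"
  shows "openin (seminorm_topology S Q) U"
proof -
  have subbasis: "openin (seminorm_topology S Q) {y \<in> S. q (y - x) < r}"
    if q: "q \<in> P" and x: "x \<in> S" and r: "r > 0" for q x r
  proof (subst openin_subopen, intro ballI)
    fix y assume "y \<in> {y \<in> S. q (y - x) < r}"
    then have y: "y \<in> S" "q (y - x) < r" by auto
    obtain q' C where q': "q' \<in> Q" "C > 0" "\<And>z. z \<in> S \<Longrightarrow> q z \<le> C * q' z"
      using dominated[OF q] by blast
    define \<epsilon> where "\<epsilon> = (r - q (y - x)) / C"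
    have \<epsilon>: "\<epsilon> > 0" using y q' by (simp add: \<epsilon>_def)
    let ?B = "{z \<in> S. q' (z - y) < \<epsilon>}"
    have "openin (seminorm_topology S Q) ?B"
      unfolding seminorm_topology_def
      by (rule topology_generated_by_Basis) (use q' y \<epsilon> in blast)
    moreover have "y \<in> ?B" using y \<epsilon> zero[OF q'(1)] by simp
    moreover have "?B \<subseteq> {y \<in> S. q (y - x) < r}"
    proof safe
      fix z assume z: "z \<in> S" "q' (z - y) < \<epsilon>"
      have "q (z - x) \<le> q (z - y) + q (y - x)"
        using subadd[OF q, of "z - y" "y - x"] by simp
      also have "q (z - y) \<le> C * q' (z - y)" using q' minus z y by blast
      also have "C * q' (z - y) < C * \<epsilon>" using z q' by simp
      also have "C * \<epsilon> = r - q (y - x)" using q' by (simp add: \<epsilon>_def)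
      finally show "q (z - x) < r" by simp
    qed
    ultimately show "\<exists>T. openin (seminorm_topology S Q) T \<and> y \<in> T \<and> T \<subseteq> {y \<in> S. q (y - x) < r}"
      by blast
  qed
  show ?thesis
  proof (rule generate_topology_on_coarsest[OF istopology_openin])
    show "generate_topology_on {{y \<in> S. q (y - x) < r} | q x r. q \<in> P \<and> x \<in> S \<and> r > 0} U"
      using U by (simp add: seminorm_topology_def openin_topology_generated_by_iff)
  qed (use subbasis in blast)
qed

section \<open>Homogeneous components\<close>

lemma lookup_component:
  "Poly_Mapping.lookup (component n a) w = (if length w = n then Poly_Mapping.lookup a w else 0)"
  by (simp add: component.rep_eq)

lemma component_add: "component n (a + b) = component n a + component n b"
  by (rule poly_mapping_eqI) (simp add: lookup_component lookup_add)

lemma component_zero: "component n 0 = 0"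
  by (rule poly_mapping_eqI) (simp add: lookup_component)

lemma component_in_tensor_power: "component n a \<in> tensor_power n"
  by (auto simp: tensor_power_def in_keys_iff lookup_component split: if_splits)

lemma component_eventually_zero: "\<exists>N. \<forall>n>N. component n a = 0"
proof (intro exI allI impI)
  fix n assume n: "n > Max (insert 0 (length ` Poly_Mapping.keys a))"
  show "component n a = 0"
  proof (rule poly_mapping_eqI)
    fix w
    have "Poly_Mapping.lookup a w = 0" if "length w = n"
    proof (rule ccontr)
      assume "Poly_Mapping.lookup a w \<noteq> 0"
      then have "length w \<le> Max (insert 0 (length ` Poly_Mapping.keys a))"
        by (intro Max_ge) (auto simp: in_keys_iff)
      with n that show False by linarith
    qed
    then show "Poly_Mapping.lookup (component n a) w = Poly_Mapping.lookup 0 w"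
      by (simp add: lookup_component)
  qed
qed

text \<open>Words with the same letters are rearrangements of each other, and the coefficients of a
  symmetric tensor are invariant under rearrangement.\<close>

lemma symmetric_algebra_lookup_mset:
  assumes a: "a \<in> symmetric_algebra" and eq: "mset u = mset w"
  shows "Poly_Mapping.lookup a u = Poly_Mapping.lookup a w"
proof -
  obtain \<sigma> where \<sigma>: "\<sigma> permutes {..<length w}" "permute_list \<sigma> w = u"
    using mset_eq_permutation[OF eq] by blast
  have "component (length w) a \<in> symmetric_power (length w)"
    using a by (simp add: symmetric_algebra_def)
  then have "Poly_Mapping.lookup (component (length w) a) (permute_list \<sigma> w)
      = Poly_Mapping.lookup (component (length w) a) w"
    using \<sigma>(1) unfolding symmetric_power_def by blast
  then show ?thesis using \<sigma> by (auto simp: lookup_component)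
qed

lemma symmetric_algebra_diff:
  assumes "a \<in> symmetric_algebra" "b \<in> symmetric_algebra"
  shows "a - b \<in> symmetric_algebra"
proof -
  have "Poly_Mapping.lookup (a - b) (permute_list \<sigma> w) = Poly_Mapping.lookup (a - b) w"
    if "\<sigma> permutes {..<length w}" for \<sigma> w
    using assms[THEN symmetric_algebra_lookup_mset, of "permute_list \<sigma> w" w] that
    by (simp add: lookup_minus)
  then show ?thesis
    using component_in_tensor_power[of _ "a - b"]
    by (auto simp: symmetric_algebra_def symmetric_power_def lookup_component)
qed

lemma polynomial_of_zero: "polynomial_of 0 x = 0"
  by (simp add: polynomial_of_def)

lemma polynomial_of_component_sum:
  assumes N: "\<forall>n>N. component n a = 0"
  shows "polynomial_of a x = (\<Sum>n\<le>N. polynomial_of (component n a) x)"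
proof -
  have "finite I \<Longrightarrow> polynomial_of (sum f I) x = (\<Sum>i\<in>I. polynomial_of (f i) x)"
    for f :: "nat \<Rightarrow> 'a tensor" and I
    by (induction I rule: finite_induct) (auto simp: polynomial_of_zero polynomial_of_add)
  moreover have "a = (\<Sum>n\<le>N. component n a)"
  proof (rule poly_mapping_eqI)
    fix w
    have "Poly_Mapping.lookup a w = 0" if "length w > N"
      using arg_cong[OF N[rule_format, OF that], of "\<lambda>t. Poly_Mapping.lookup t w"] by (simp add: lookup_component)
    then show "Poly_Mapping.lookup a w = Poly_Mapping.lookup (\<Sum>n\<le>N. component n a) w"
      by (auto simp: lookup_sum lookup_component)
  qed
  ultimately show ?thesis by (metis finite_atMost)
qed

section \<open>The projective seminorm\<close>

lemma complex_seminorm_nonneg: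
  assumes "complex_seminorm q" shows "q v \<ge> 0"
proof -
  have "q (c *s x) = cmod c * q x" for c x
    using assms by (simp add: complex_seminorm_def)
  from this[of 0 v] this[of "-1" v] have "q 0 = 0" "q (- v) = q v"
    by (simp_all add: vector_sneg_minus1[symmetric])
  moreover have "q (v + - v) \<le> q v + q (- v)"
    using assms unfolding complex_seminorm_def by blast
  ultimately show ?thesis by simp
qed

lemma prod_list_map_nonneg: "(\<And>x. x \<in> set xs \<Longrightarrow> f x \<ge> 0) \<Longrightarrow> (\<Prod>x\<leftarrow>xs. f x) \<ge> (0::real)"
  by (induction xs) auto

lemma decomposition_cost_nonneg:
  assumes "complex_seminorm q"
  shows "(\<Sum>vs\<leftarrow>vss. \<Prod>v\<leftarrow>vs. q v) \<ge> 0"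
  by (intro sum_list_nonneg) (auto intro!: prod_list_map_nonneg complex_seminorm_nonneg[OF assms])

lemma projective_seminorm_le:
  assumes q: "complex_seminorm q" and n: "n > 0"
    and "\<forall>vs\<in>set vss. length vs = n" "t = (\<Sum>vs\<leftarrow>vss. elementary_tensor vs)"
  shows "projective_seminorm q n t \<le> (\<Sum>vs\<leftarrow>vss. \<Prod>v\<leftarrow>vs. q v)"
  using assms unfolding projective_seminorm_def
  by (auto intro!: cInf_lower bdd_belowI[of _ 0] decomposition_cost_nonneg)

text \<open>The factors of the basis tensor of a nonempty word.  The coefficient is absorbed into the first
  factor because decompositions are sums of elementary tensors without coefficients.\<close>

definition scaled_word :: "complex \<Rightarrow> 'n list \<Rightarrow> (complex^'n) list" where
  "scaled_word c w = (c *s axis (hd w) 1) # map (\<lambda>i. axis i 1) (tl w)"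

lemma elementary_tensor_scaled_word:
  assumes "w \<noteq> []"
  shows "elementary_tensor (scaled_word c w) = Poly_Mapping.single (w :: 'n::finite list) c"
proof (rule poly_mapping_eqI)
  fix u :: "'n list"
  obtain i w' where w: "w = i # w'" using assms by (cases w) auto
  show "Poly_Mapping.lookup (elementary_tensor (scaled_word c w)) u
      = Poly_Mapping.lookup (Poly_Mapping.single w c) u"
  proof (cases "length u = length w")
    case False
    then show ?thesis
      by (auto simp: scaled_word_def elementary_tensor.rep_eq lookup_single when_def w)
  next
    case True
    then obtain j u' where u: "u = j # u'" by (cases u) (auto simp: w)
    have "(\<Prod>k<length w'. axis (w' ! k) (1::complex) $ (u' ! k)) = (if u' = w' then 1 else 0)"
    proof (cases "u' = w'")
      case False
      then obtain k where "k < length w'" "u' ! k \<noteq> w' ! k"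
        using True by (auto simp: u w list_eq_iff_nth_eq)
      then have "\<exists>k\<in>{..<length w'}. axis (w' ! k) (1::complex) $ (u' ! k) = 0"
        by (auto simp: axis_def)
      then show ?thesis using False by (simp add: prod_zero)
    qed (simp add: axis_def)
    then show ?thesis using True
      by (auto simp: scaled_word_def elementary_tensor.rep_eq lookup_single when_def w u
          prod.lessThan_Suc_shift axis_def simp del: prod.lessThan_Suc)
  qed
qed

lemma basis_decomposition:
  fixes t :: "'n::finite tensor"
  assumes t: "t \<in> tensor_power n" and n: "n > 0"
  obtains ws where "distinct ws" "set ws = Poly_Mapping.keys t"
    and "\<forall>vs\<in>set (map (\<lambda>w. scaled_word (Poly_Mapping.lookup t w) w) ws). length vs = n"
    and "t = (\<Sum>vs\<leftarrow>map (\<lambda>w. scaled_word (Poly_Mapping.lookup t w) w) ws. elementary_tensor vs)"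
proof -
  let ?K = "Poly_Mapping.keys t"
  let ?e = "\<lambda>w. scaled_word (Poly_Mapping.lookup t w) w"
  obtain ws where ws: "set ws = ?K" "distinct ws"
    using finite_distinct_list[of ?K] by auto
  have len: "length w = n" if "w \<in> ?K" for w using t that by (simp add: tensor_power_def)
  have ne: "w \<noteq> []" if "w \<in> ?K" for w using len[OF that] n by auto
  have "t = (\<Sum>w\<in>?K. Poly_Mapping.single w (Poly_Mapping.lookup t w))"
    by (rule poly_mapping_eqI) (auto simp: lookup_sum lookup_single when_def in_keys_iff)
  also have "\<dots> = (\<Sum>w\<in>?K. elementary_tensor (?e w))"
    by (intro sum.cong refl) (simp add: elementary_tensor_scaled_word ne)
  also have "\<dots> = (\<Sum>vs\<leftarrow>map ?e ws. elementary_tensor vs)"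
    using sum.distinct_set_conv_list[OF ws(2), of "\<lambda>w. elementary_tensor (?e w)"] ws(1)
    by (simp add: comp_def)
  finally have "t = (\<Sum>vs\<leftarrow>map ?e ws. elementary_tensor vs)" .
  moreover have "\<forall>vs\<in>set (map ?e ws). length vs = n"
    using len ne n ws by (auto simp: scaled_word_def)
  ultimately show ?thesis using that ws by blast
qed

lemma projective_seminorm_le_coefficients:
  assumes q: "complex_seminorm q" and t: "t \<in> tensor_power n"
    and c: "\<And>i. q (axis i 1) \<le> c"
  shows "projective_seminorm q n t \<le> c ^ n * (\<Sum>w\<in>Poly_Mapping.keys t. cmod (Poly_Mapping.lookup t w))"
proof (cases "n = 0")
  case True
  let ?K = "Poly_Mapping.keys t"
  have "cmod (Poly_Mapping.lookup t []) \<le> (\<Sum>w\<in>?K. cmod (Poly_Mapping.lookup t w))"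
  proof (cases "[] \<in> ?K")
    case True
    then show ?thesis
      by (intro member_le_sum[where f = "\<lambda>w. cmod (Poly_Mapping.lookup t w)"]) auto
  qed (auto simp: in_keys_iff intro!: sum_nonneg)
  then show ?thesis by (simp add: projective_seminorm_def True)
next
  case False
  then have n: "n > 0" by simp
  let ?K = "Poly_Mapping.keys t"
  let ?e = "\<lambda>w. scaled_word (Poly_Mapping.lookup t w) w"
  obtain ws where ws: "distinct ws" "set ws = ?K" "\<forall>vs\<in>set (map ?e ws). length vs = n"
    "t = (\<Sum>vs\<leftarrow>map ?e ws. elementary_tensor vs)"
    using basis_decomposition[OF t n] .
  have c0: "c \<ge> 0" using c complex_seminorm_nonneg[OF q] order_trans by blast
  have "projective_seminorm q n t \<le> (\<Sum>vs\<leftarrow>map ?e ws. \<Prod>v\<leftarrow>vs. q v)"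
    by (rule projective_seminorm_le[OF q n ws(3,4)])
  also have "\<dots> = (\<Sum>w\<in>?K. \<Prod>v\<leftarrow>?e w. q v)"
    using sum.distinct_set_conv_list[OF ws(1), of "\<lambda>w. \<Prod>v\<leftarrow>?e w. q v"] ws(2)
    by (simp add: comp_def)
  also have "\<dots> \<le> (\<Sum>w\<in>?K. c ^ n * cmod (Poly_Mapping.lookup t w))"
  proof (rule sum_mono)
    fix w assume "w \<in> ?K"
    then have "length w = n" using t by (simp add: tensor_power_def)
    then obtain i w' where w: "w = i # w'" "length w' = n - 1" using n by (cases w) auto
    have homogeneous: "q (z *s v) = cmod z * q v" for z v
      using q by (simp add: complex_seminorm_def)
    have rest: "(\<Prod>i\<leftarrow>u. q (axis i 1)) \<le> c ^ length u" for u
      by (induction u) (auto intro!: mult_mono c c0 prod_list_map_nonneg complex_seminorm_nonneg[OF q])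
    have "q (axis i 1) * (\<Prod>i\<leftarrow>w'. q (axis i 1)) \<le> c * c ^ length w'"
      by (intro mult_mono c c0 rest prod_list_map_nonneg complex_seminorm_nonneg[OF q])
    also have "c * c ^ length w' = c ^ n" using w n by (simp flip: power_Suc)
    finally have *: "q (axis i 1) * (\<Prod>i\<leftarrow>w'. q (axis i 1)) \<le> c ^ n" .
    show "(\<Prod>v\<leftarrow>?e w. q v) \<le> c ^ n * cmod (Poly_Mapping.lookup t w)"
      using mult_left_mono[OF *, of "cmod (Poly_Mapping.lookup t w)"]
      by (simp add: scaled_word_def w homogeneous comp_def mult_ac)
  qed
  finally show ?thesis by (simp add: sum_distrib_left)
qed

lemma elementary_decomposition_exists:
  fixes t :: "'n::finite tensor"
  assumes "t \<in> tensor_power n" "n > 0"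
  shows "\<exists>vss. (\<forall>vs\<in>set vss. length vs = n) \<and> t = (\<Sum>vs\<leftarrow>vss. elementary_tensor vs)"
proof (rule basis_decomposition[OF assms])
  fix ws
  let ?vss = "map (\<lambda>w. scaled_word (Poly_Mapping.lookup t w) w) ws"
  assume "\<forall>vs\<in>set ?vss. length vs = n" "t = (\<Sum>vs\<leftarrow>?vss. elementary_tensor vs)"
  then show ?thesis by (intro exI[of _ ?vss] conjI)
qed

text \<open>A lower bound for the cost of every decomposition is one for the infimum only because
  decompositions exist.\<close>

lemma projective_seminorm_greatest:
  fixes q :: "complex^'n::finite \<Rightarrow> real"
  assumes "t \<in> tensor_power n" "n > 0"
    and "\<And>vss. \<forall>vs\<in>set vss. length vs = n \<Longrightarrow> t = (\<Sum>vs\<leftarrow>vss. elementary_tensor vs) \<Longrightarrow>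
      L \<le> (\<Sum>vs\<leftarrow>vss. \<Prod>v\<leftarrow>vs. q v)"
  shows "L \<le> projective_seminorm q n t"
proof -
  obtain vss :: "(complex^'n) list list"
    where "\<forall>vs\<in>set vss. length vs = n" "t = (\<Sum>vs\<leftarrow>vss. elementary_tensor vs)"
    using elementary_decomposition_exists[OF assms(1,2)] by blast
  then show ?thesis
    using assms(2,3) unfolding projective_seminorm_def by (auto intro!: cInf_greatest)
qed

lemma projective_seminorm_nonneg:
  assumes "complex_seminorm q" "t \<in> tensor_power n"
  shows "projective_seminorm q n t \<ge> 0"
proof (cases "n = 0")
  case False
  then show ?thesis
    using assms by (intro projective_seminorm_greatest decomposition_cost_nonneg) auto
qed (simp add: projective_seminorm_def)

lemma tensor_power_zero: "0 \<in> tensor_power n"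
  by (simp add: tensor_power_def)

lemma projective_seminorm_zero:
  assumes "complex_seminorm q"
  shows "projective_seminorm q n 0 = 0"
proof (cases "n = 0")
  case False
  then have "projective_seminorm q n 0 \<le> (\<Sum>vs\<leftarrow>[]. \<Prod>v\<leftarrow>vs. q v)"
    using assms by (intro projective_seminorm_le) auto
  with projective_seminorm_nonneg[OF assms tensor_power_zero, of n] show ?thesis by simp
qed (simp add: projective_seminorm_def)

text \<open>A decomposition of \<open>t\<close> followed by one of \<open>u\<close> is a decomposition of \<open>t + u\<close> whose cost is the
  sum of the two costs.\<close>

lemma projective_seminorm_add:
  fixes t u :: "'n::finite tensor"
  assumes q: "complex_seminorm q" and t: "t \<in> tensor_power n" and u: "u \<in> tensor_power n"
  shows "projective_seminorm q n (t + u) \<le> projective_seminorm q n t + projective_seminorm q n u"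
proof (cases "n = 0")
  case True
  then show ?thesis by (simp add: projective_seminorm_def lookup_add norm_triangle_ineq)
next
  case False
  then have n: "n > 0" by simp
  let ?L = "projective_seminorm q n (t + u)"
  let ?cost = "\<lambda>vss. \<Sum>vs\<leftarrow>vss. \<Prod>v\<leftarrow>vs. q v"
  have "?L - projective_seminorm q n u \<le> projective_seminorm q n t"
  proof (rule projective_seminorm_greatest[OF t n])
    fix vss assume vss: "\<forall>vs\<in>set vss. length vs = n" "t = (\<Sum>vs\<leftarrow>vss. elementary_tensor vs)"
    have "?L - ?cost vss \<le> projective_seminorm q n u"
    proof (rule projective_seminorm_greatest[OF u n])
      fix wss assume "\<forall>vs\<in>set wss. length vs = n" "u = (\<Sum>vs\<leftarrow>wss. elementary_tensor vs)"
      with vss have "?L \<le> ?cost (vss @ wss)"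
        by (intro projective_seminorm_le[OF q n]) auto
      then show "?L - ?cost vss \<le> ?cost wss" by simp
    qed
    then show "?L - projective_seminorm q n u \<le> ?cost vss" by simp
  qed
  then show ?thesis by simp
qed

section \<open>The weighted seminorms\<close>

lemma weighted_seminorm_eq_sum:
  assumes "complex_seminorm q" and "\<forall>n>N. component n a = 0"
  shows "weighted_seminorm R q a
       = (\<Sum>n\<le>N. projective_seminorm q n (component n a) * fact n powr R)"
  unfolding weighted_seminorm_def
  by (rule suminf_finite) (use assms in \<open>auto simp: projective_seminorm_zero not_le\<close>)

lemma weighted_seminorm_zero:
  assumes "complex_seminorm q" shows "weighted_seminorm R q 0 = 0"
  using assms by (simp add: weighted_seminorm_def component_zero projective_seminorm_zero)

lemma weighted_seminorm_add:
  assumes q: "complex_seminorm q"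
  shows "weighted_seminorm R q (a + b) \<le> weighted_seminorm R q a + weighted_seminorm R q b"
proof -
  obtain K L where K: "\<And>n. n > K \<Longrightarrow> component n a = 0" and L: "\<And>n. n > L \<Longrightarrow> component n b = 0"
    using component_eventually_zero by metis
  define N where "N = max K L"
  have "weighted_seminorm R q (a + b)
      = (\<Sum>n\<le>N. projective_seminorm q n (component n a + component n b) * fact n powr R)"
    by (subst weighted_seminorm_eq_sum[OF q, of N]) (auto simp: N_def K L component_add)
  also have "\<dots> \<le> (\<Sum>n\<le>N. (projective_seminorm q n (component n a)
      + projective_seminorm q n (component n b)) * fact n powr R)"
    by (intro sum_mono mult_right_mono projective_seminorm_add q component_in_tensor_power) auto
  also have "\<dots> = weighted_seminorm R q a + weighted_seminorm R q b"
    using K L by (subst (1 2) weighted_seminorm_eq_sum[OF q, of N])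
      (auto simp: N_def distrib_right sum.distrib)
  finally show ?thesis .
qed

section \<open>Growth is controlled by the weighted seminorms\<close>

lemma complex_seminorm_scaled_norm:
  assumes "K \<ge> 0"
  shows "complex_seminorm (\<lambda>v :: complex^'n::finite. K * norm v)"
proof -
  have "norm (c *s v) = cmod c * norm v" for c and v :: "complex^'n"
    by (simp add: norm_vec_def norm_mult L2_set_right_distrib)
  moreover have "K * norm (v + w) \<le> K * norm v + K * norm w" for v w :: "complex^'n"
    using mult_left_mono[OF norm_triangle_ineq assms] by (simp add: distrib_left)
  ultimately show ?thesis by (simp add: complex_seminorm_def)
qed

lemma norm_vector_pairing_le:
  fixes v x :: "complex^'n::finite"
  shows "cmod (\<Sum>i\<in>UNIV. v $ i * x $ i) \<le> norm v * norm x"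
proof -
  have "cmod (\<Sum>i\<in>UNIV. v $ i * x $ i) \<le> (\<Sum>i\<in>UNIV. \<bar>cmod (v $ i)\<bar> * \<bar>cmod (x $ i)\<bar>)"
    using norm_sum[of "\<lambda>i. v $ i * x $ i" UNIV] by (simp add: norm_mult)
  also have "\<dots> \<le> norm v * norm x"
    unfolding norm_vec_def by (rule L2_set_mult_ineq)
  finally show ?thesis .
qed

text \<open>Splitting off one factor makes the multiplicativity of \<open>polynomial_of\<close> applicable, so that an
  elementary tensor becomes a product of linear forms.\<close>

lemma elementary_tensor_Cons:
  "elementary_tensor (v # vs) = tensor_mult (elementary_tensor [v]) (elementary_tensor vs)"
proof (rule poly_mapping_eqI)
  fix w
  let ?f = "\<lambda>k. Poly_Mapping.lookup (elementary_tensor [v]) (take k w)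
                * Poly_Mapping.lookup (elementary_tensor vs) (drop k w)"
  show "Poly_Mapping.lookup (elementary_tensor (v # vs)) w
      = Poly_Mapping.lookup (tensor_mult (elementary_tensor [v]) (elementary_tensor vs)) w"
  proof (cases w)
    case Nil
    then show ?thesis by (simp add: elementary_tensor.rep_eq tensor_mult.rep_eq)
  next
    case (Cons i w')
    have "(\<Sum>k\<le>length w. ?f k) = (\<Sum>k\<in>{1}. ?f k)"
      by (rule sum.mono_neutral_right) (auto simp: Cons elementary_tensor.rep_eq)
    then show ?thesis
      by (auto simp: Cons elementary_tensor.rep_eq tensor_mult.rep_eq prod.lessThan_Suc_shift
          simp del: prod.lessThan_Suc)
  qed
qed

lemma polynomial_of_vector:
  "polynomial_of (elementary_tensor [v]) x = (\<Sum>i\<in>UNIV. v $ i * x $ i)"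
proof -
  have "polynomial_of (elementary_tensor [v]) x
      = (\<Sum>w\<in>range (\<lambda>i. [i]). Poly_Mapping.lookup (elementary_tensor [v]) w * (\<Prod>i\<leftarrow>w. x $ i))"
    by (rule polynomial_of_superset)
       (auto simp: in_keys_iff elementary_tensor.rep_eq length_Suc_conv split: if_splits)
  also have "\<dots> = (\<Sum>i\<in>UNIV. v $ i * x $ i)"
    by (subst sum.reindex) (auto simp: inj_on_def elementary_tensor.rep_eq)
  finally show ?thesis .
qed

lemma norm_polynomial_of_elementary_tensor_le:
  "cmod (polynomial_of (elementary_tensor vs) x) \<le> (\<Prod>v\<leftarrow>vs. norm v) * norm x ^ length vs"
proof (induction vs)
  case Nil
  then show ?case by (simp add: polynomial_of_one)
next
  case (Cons v vs)
  have "cmod (polynomial_of (elementary_tensor (v # vs)) x)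
      \<le> (norm v * norm x) * ((\<Prod>v\<leftarrow>vs. norm v) * norm x ^ length vs)"
    unfolding elementary_tensor_Cons[of v vs] polynomial_of_tensor_mult norm_mult polynomial_of_vector
    by (intro mult_mono norm_vector_pairing_le Cons.IH) auto
  then show ?case by (simp add: mult_ac)
qed

text \<open>Every decomposition of \<open>t\<close> into elementary tensors gives this bound with its own cost, by
  Cauchy-Schwarz for each factor; then take the infimum over the decompositions.  The factor \<open>K\<close>
  is carried along because it is the freedom that absorbs the parameter \<open>s\<close> below.\<close>

lemma norm_polynomial_of_le_projective:
  fixes t :: "'n::finite tensor"
  assumes K: "K > 0" and t: "t \<in> tensor_power n"
  shows "cmod (polynomial_of t x) \<le> projective_seminorm (\<lambda>v. K * norm v) n t * (norm x / K) ^ n"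
proof (cases "n = 0")
  case True
  then have "Poly_Mapping.keys t \<subseteq> {[]}" using t by (auto simp: tensor_power_def)
  then show ?thesis
    using True by (subst polynomial_of_superset[of "{[]}"]) (auto simp: projective_seminorm_def)
next
  case False
  then have n: "n > 0" by simp
  have bound: "cmod (polynomial_of t x) \<le> (\<Sum>vs\<leftarrow>vss. \<Prod>v\<leftarrow>vs. K * norm v) * (norm x / K) ^ n"
    if vss: "\<forall>vs\<in>set vss. length vs = n" "t = (\<Sum>vs\<leftarrow>vss. elementary_tensor vs)" for vss
    using vss
  proof (induction vss arbitrary: t)
    case Nil
    then show ?case by (simp add: polynomial_of_zero)
  next
    case (Cons vs vss)
    have "(\<Prod>v\<leftarrow>us. K * norm v) = K ^ length us * (\<Prod>v\<leftarrow>us. norm v)" for us :: "(complex^'n) list"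
      by (induction us) auto
    then have head: "cmod (polynomial_of (elementary_tensor vs) x)
        \<le> (\<Prod>v\<leftarrow>vs. K * norm v) * (norm x / K) ^ n"
      using norm_polynomial_of_elementary_tensor_le[of vs x] Cons.prems K
      by (simp add: power_divide)
    have "cmod (polynomial_of t x) \<le> cmod (polynomial_of (elementary_tensor vs) x)
        + cmod (polynomial_of (\<Sum>vs\<leftarrow>vss. elementary_tensor vs) x)"
      using Cons.prems by (simp add: polynomial_of_add norm_triangle_ineq)
    also have "\<dots> \<le> (\<Prod>v\<leftarrow>vs. K * norm v) * (norm x / K) ^ n
        + (\<Sum>vs\<leftarrow>vss. \<Prod>v\<leftarrow>vs. K * norm v) * (norm x / K) ^ n"
      using Cons.prems by (intro add_mono head Cons.IH) auto
    finally show ?case by (simp add: distrib_right)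
  qed
  \<comment> \<open>Passing to the infimum divides by \<open>(norm x / K) ^ n\<close>, so the origin is treated on its own.\<close>
  show ?thesis
  proof (cases "norm x = 0")
    case True
    obtain vss where "\<forall>vs\<in>set vss. length vs = n" "t = (\<Sum>vs\<leftarrow>vss. elementary_tensor vs)"
      using elementary_decomposition_exists[OF t n] by blast
    from bound[OF this] show ?thesis using True n by (simp add: power_0_left)
  next
    case False
    have "cmod (polynomial_of t x) / (norm x / K) ^ n \<le> projective_seminorm (\<lambda>v. K * norm v) n t"
      by (rule projective_seminorm_greatest[OF t n])
         (use bound False K in \<open>simp add: pos_divide_le_eq\<close>)
    then show ?thesis using False K by (simp add: pos_divide_le_eq)
  qed
qed

lemma power_powr_commute: "(x ^ n) powr r = (x powr r) ^ n" if "x > 0" for x r :: real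
  using that by (simp add: powr_powr mult.commute flip: powr_realpow)

text \<open>This is \<open>y\<^sup>n exp (- y) \<le> n!\<close>, a single term of the exponential series, raised to the power
  \<open>1 / p\<close>, for \<open>y = p s r\<^sup>p\<close>.\<close>

lemma power_le_fact_powr_mult_exp:
  fixes p s r :: real
  assumes p: "p > 0" and s: "s > 0" and r: "r \<ge> 0"
  shows "(r / (p * s) powr (- (1 / p))) ^ n * exp (- s * r powr p) \<le> fact n powr (1 / p)"
proof (cases "r = 0")
  case True
  then show ?thesis by (cases n) auto
next
  case False
  then have r: "r > 0" using r by simp
  define y where "y = p * s * r powr p"
  have y: "y > 0" using p s r by (simp add: y_def)
  have root: "r / (p * s) powr (- (1 / p)) = y powr (1 / p)"
    using p s r by (simp add: y_def powr_mult powr_powr powr_minus divide_simps)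
  have exp: "exp (- s * r powr p) = exp (- y) powr (1 / p)"
    using p by (simp add: y_def powr_def mult_ac)
  have "y ^ n / fact n \<le> exp y"
  proof -
    have "(\<Sum>k\<in>{n}. y ^ k /\<^sub>R fact k) \<le> suminf (\<lambda>k. y ^ k /\<^sub>R fact k)"
      by (rule sum_le_suminf) (use y summable_exp_generic[of y] in auto)
    then show ?thesis by (simp add: exp_def divide_inverse mult.commute)
  qed
  then have "y ^ n * exp (- y) \<le> fact n"
    by (simp add: exp_minus divide_simps mult.commute)
  then have "(y ^ n * exp (- y)) powr (1 / p) \<le> fact n powr (1 / p)"
    using p y by (intro powr_mono2) auto
  moreover have "(y ^ n * exp (- y)) powr (1 / p) = (y powr (1 / p)) ^ n * exp (- y) powr (1 / p)"
    using y by (simp add: powr_mult power_powr_commute)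
  ultimately show ?thesis by (simp only: root exp)
qed

text \<open>The pointwise form of the bound comes first because it shows that the supremum in
  \<open>growth_norm\<close> is over a bounded set.\<close>

lemma polynomial_of_growth_le_weighted:
  fixes a :: "'n::finite tensor"
  assumes p: "p > 0" and s: "s > 0"
  shows "cmod (polynomial_of a x) * exp (- s * norm x powr p)
       \<le> weighted_seminorm (1 / p) (\<lambda>v. (p * s) powr (- (1 / p)) * norm v) a"
proof -
  define K where "K = (p * s) powr (- (1 / p))"
  have K: "K > 0" using p s by (simp add: K_def)
  let ?q = "\<lambda>v :: complex^'n. K * norm v"
  have q: "complex_seminorm ?q" using K by (intro complex_seminorm_scaled_norm) simp
  obtain N where N: "\<forall>n>N. component n a = 0" using component_eventually_zero by blast
  have "cmod (polynomial_of a x) * exp (- s * norm x powr p)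
      \<le> (\<Sum>n\<le>N. cmod (polynomial_of (component n a) x)) * exp (- s * norm x powr p)"
    unfolding polynomial_of_component_sum[OF N] by (intro mult_right_mono norm_sum) auto
  also have "\<dots> = (\<Sum>n\<le>N. cmod (polynomial_of (component n a) x) * exp (- s * norm x powr p))"
    by (simp add: sum_distrib_right)
  also have "\<dots> \<le> (\<Sum>n\<le>N. projective_seminorm ?q n (component n a) * fact n powr (1 / p))"
  proof (rule sum_mono)
    fix n
    have "cmod (polynomial_of (component n a) x) * exp (- s * norm x powr p)
        \<le> (projective_seminorm ?q n (component n a) * (norm x / K) ^ n) * exp (- s * norm x powr p)"
      by (intro mult_right_mono norm_polynomial_of_le_projective K component_in_tensor_power) auto
    also have "\<dots> = projective_seminorm ?q n (component n a)
        * ((norm x / K) ^ n * exp (- s * norm x powr p))" by simp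
    also have "\<dots> \<le> projective_seminorm ?q n (component n a) * fact n powr (1 / p)"
      unfolding K_def
      by (intro mult_left_mono power_le_fact_powr_mult_exp p s projective_seminorm_nonneg
          component_in_tensor_power q[unfolded K_def]) auto
    finally show "cmod (polynomial_of (component n a) x) * exp (- s * norm x powr p)
        \<le> projective_seminorm ?q n (component n a) * fact n powr (1 / p)" .
  qed
  also have "\<dots> = weighted_seminorm (1 / p) ?q a"
    by (rule weighted_seminorm_eq_sum[OF q N, symmetric])
  finally show ?thesis by (simp add: K_def)
qed

lemma growth_norm_upper:
  assumes "p > 0" "s > 0"
  shows "cmod (polynomial_of a x) * exp (- s * norm x powr p) \<le> growth_norm p s a"
  unfolding growth_norm_def
  by (rule cSUP_upper[OF UNIV_I bdd_aboveI2[OF polynomial_of_growth_le_weighted[OF assms]]])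

lemma growth_norm_le_weighted:
  assumes "p > 0" "s > 0"
  shows "growth_norm p s a
       \<le> weighted_seminorm (1 / p) (\<lambda>v. (p * s) powr (- (1 / p)) * norm v) a"
  unfolding growth_norm_def
  by (rule cSUP_least[OF UNIV_not_empty polynomial_of_growth_le_weighted[OF assms]])

lemma growth_norm_zero: "growth_norm p s 0 = 0"
  by (simp add: growth_norm_def polynomial_of_zero)

lemma growth_norm_add:
  assumes "p > 0" "s > 0"
  shows "growth_norm p s (a + b) \<le> growth_norm p s a + growth_norm p s b"
  unfolding growth_norm_def[of p s "a + b"]
proof (rule cSUP_least)
  fix x
  have "cmod (polynomial_of (a + b) x) * exp (- s * norm x powr p)
      \<le> (cmod (polynomial_of a x) + cmod (polynomial_of b x)) * exp (- s * norm x powr p)"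
    unfolding polynomial_of_add by (intro mult_right_mono norm_triangle_ineq) auto
  also have "\<dots> \<le> growth_norm p s a + growth_norm p s b"
    unfolding distrib_right by (intro add_mono growth_norm_upper assms)
  finally show "cmod (polynomial_of (a + b) x) * exp (- s * norm x powr p)
      \<le> growth_norm p s a + growth_norm p s b" .
qed auto

section \<open>Cauchy estimates\<close>

text \<open>Averages over the \<open>N\<close>-th roots of unity separate the exponents below \<open>N\<close>.  For polynomials they
  replace the integral over the circle in Cauchy's formula exactly.\<close>

lemma sum_roots_of_unity_orthogonal:
  fixes N k l :: nat
  defines "\<omega> \<equiv> exp (2 * of_real pi * \<i> / of_nat N)"
  assumes "k < N" "l < N"
  shows "(\<Sum>j<N. (\<omega> ^ j) ^ k * cnj (\<omega> ^ j) ^ l) = (if k = l then of_nat N else 0)"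
proof -
  define z where "z = \<omega> ^ k * cnj \<omega> ^ l"
  have N: "N \<ge> 1" using assms by simp
  have power: "\<omega> ^ j = exp (2 * of_real pi * \<i> * of_nat j / of_nat N)" for j
    by (simp add: \<omega>_def mult_ac flip: exp_of_nat_mult)
  have unit: "\<omega> * cnj \<omega> = 1"
    by (simp add: \<omega>_def exp_cnj flip: exp_add)
  have unit_power: "\<omega> ^ j * cnj \<omega> ^ j = 1" for j
    by (simp add: unit flip: power_mult_distrib)
  have "\<omega> ^ N = 1" using N by (simp add: power)
  moreover then have "cnj \<omega> ^ N = 1" by (metis complex_cnj_one complex_cnj_power)
  ultimately have zN: "z ^ N = 1"
    by (simp add: z_def power_mult_distrib flip: power_mult)
       (simp add: mult.commute power_mult)
  have "k = l" if "z = 1"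
  proof -
    have "\<omega> ^ k = \<omega> ^ k * (\<omega> ^ l * cnj \<omega> ^ l)" by (simp add: unit_power)
    also have "\<dots> = z * \<omega> ^ l" by (simp add: z_def)
    finally have "\<omega> ^ k = \<omega> ^ l" using that by simp
    then show ?thesis
      using complex_root_unity_eq[OF N, of k l] assms(2,3) unfolding power by simp
  qed
  moreover have "z = 1" if "k = l" using that by (simp add: z_def unit_power)
  moreover have "(\<Sum>j<N. (\<omega> ^ j) ^ k * cnj (\<omega> ^ j) ^ l) = (\<Sum>j<N. z ^ j)"
    by (simp add: z_def power_mult_distrib mult.commute flip: power_mult)
  ultimately show ?thesis by (auto simp: sum_gp_strict zN)
qed

lemma prod_list_eq_prod_power_count:
  fixes x :: "'n::finite \<Rightarrow> complex"
  shows "(\<Prod>i\<leftarrow>w. x i) = (\<Prod>i\<in>UNIV. x i ^ count (mset w) i)"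
proof (induction w)
  case (Cons j w)
  have "(\<Prod>i\<in>UNIV. x i ^ count (mset (j # w)) i)
      = (\<Prod>i\<in>UNIV. (if i = j then x i else 1) * x i ^ count (mset w) i)"
    by (intro prod.cong) auto
  then show ?case by (simp add: prod.distrib Cons)
qed simp

text \<open>Averaging \<open>a\<close> against the conjugate of the monomial of \<open>w\<close> over a grid of roots of unity on the
  torus leaves exactly the words that are rearrangements of \<open>w\<close>.  By symmetry all of them have the
  same coefficient as \<open>w\<close>, and if that is nonzero, \<open>w\<close> itself is one of them; so the coefficient
  of \<open>w\<close> is in absolute value at most that of its monomial.\<close>

lemma cauchy_estimate:
  fixes a :: "'n::finite tensor"
  assumes a: "a \<in> symmetric_algebra" and \<rho>: "\<rho> > 0"
    and M: "\<And>x. (\<And>i. cmod (x $ i) = \<rho>) \<Longrightarrow> cmod (polynomial_of a x) \<le> M"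
  shows "cmod (Poly_Mapping.lookup a w) * \<rho> ^ length w \<le> M"
proof -
  let ?K = "Poly_Mapping.keys a"
  let ?a = "Poly_Mapping.lookup a"
  \<comment> \<open>\<open>N\<close> exceeds every exponent that occurs, so that the \<open>N\<close>-th roots of unity tell them apart.\<close>
  define N where "N = Suc (Max (length ` insert w ?K))"
  have count_less: "count (mset u) i < N" if "u \<in> insert w ?K" for u i
  proof -
    have "count (mset u) i \<le> length u" by (metis count_le_length count_mset)
    also have "length u \<le> Max (length ` insert w ?K)" using that by (intro Max_ge) auto
    finally show ?thesis by (simp add: N_def)
  qed
  have N: "N > 0" by (simp add: N_def)
  define \<omega> where "\<omega> = exp (2 * of_real pi * \<i> / of_nat N)"
  have norm_\<omega>: "cmod \<omega> = 1" by (simp add: \<omega>_def norm_exp_eq_Re)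
  define G where "G = (UNIV :: 'n set) \<rightarrow>\<^sub>E {..<N}"
  have card_G: "card G = N ^ CARD('n)" by (simp add: G_def card_PiE)
  define X where "X g = (\<chi> i. of_real \<rho> * \<omega> ^ g i)" for g :: "'n \<Rightarrow> nat"
  define F where "F g = polynomial_of a (X g) * (\<Prod>i\<in>UNIV. cnj (\<omega> ^ g i) ^ count (mset w) i)"
    for g :: "'n \<Rightarrow> nat"
  have average: "(\<Sum>g\<in>G. (\<Prod>i\<leftarrow>u. X g $ i) * (\<Prod>i\<in>UNIV. cnj (\<omega> ^ g i) ^ count (mset w) i))
      = (if mset u = mset w then of_real (\<rho> ^ length w) * of_nat (N ^ CARD('n)) else 0)"
    if u: "u \<in> ?K" for u
  proof -
    have "(\<Prod>i\<leftarrow>u. X g $ i) = of_real (\<rho> ^ length u) * (\<Prod>i\<in>UNIV. (\<omega> ^ g i) ^ count (mset u) i)" for g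
    proof -
      have "(\<Prod>i\<leftarrow>u. X g $ i) = of_real (\<rho> ^ length u) * (\<Prod>i\<leftarrow>u. \<omega> ^ g i)"
        unfolding X_def by (induction u) (auto simp: mult_ac)
      then show ?thesis by (simp only: prod_list_eq_prod_power_count)
    qed
    then have "(\<Sum>g\<in>G. (\<Prod>i\<leftarrow>u. X g $ i) * (\<Prod>i\<in>UNIV. cnj (\<omega> ^ g i) ^ count (mset w) i))
        = of_real (\<rho> ^ length u)
          * (\<Sum>g\<in>G. \<Prod>i\<in>UNIV. (\<omega> ^ g i) ^ count (mset u) i * cnj (\<omega> ^ g i) ^ count (mset w) i)"
      by (simp only: sum_distrib_left prod.distrib mult.assoc)
    also have "\<dots> = of_real (\<rho> ^ length u)
        * (\<Prod>i\<in>UNIV. \<Sum>j<N. (\<omega> ^ j) ^ count (mset u) i * cnj (\<omega> ^ j) ^ count (mset w) i)"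
      unfolding G_def by (subst prod_sum_PiE) auto
    also have "\<dots> = of_real (\<rho> ^ length u)
        * (\<Prod>i\<in>UNIV. if count (mset u) i = count (mset w) i then of_nat N else 0)"
      unfolding \<omega>_def using u by (subst sum_roots_of_unity_orthogonal) (auto intro!: count_less)
    also have "\<dots> = (if mset u = mset w then of_real (\<rho> ^ length w) * of_nat (N ^ CARD('n)) else 0)"
    proof (cases "mset u = mset w")
      case True
      then have "length u = length w" by (rule mset_eq_length)
      with True show ?thesis by simp
    next
      case False
      then obtain i where "count (mset u) i \<noteq> count (mset w) i" by (auto simp: multiset_eq_iff)
      then have "\<exists>i\<in>UNIV. (if count (mset u) i = count (mset w) i then of_nat N else 0 :: complex) = 0"
        by auto
      with False show ?thesis by (simp add: prod_zero)
    qed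
    finally show ?thesis .
  qed
  let ?E = "{u \<in> ?K. mset u = mset w}"
  have "(\<Sum>g\<in>G. F g)
      = (\<Sum>u\<in>?K. ?a u * (\<Sum>g\<in>G. (\<Prod>i\<leftarrow>u. X g $ i) * (\<Prod>i\<in>UNIV. cnj (\<omega> ^ g i) ^ count (mset w) i)))"
    unfolding F_def polynomial_of_def sum_distrib_right sum_distrib_left
    by (subst sum.swap) (simp only: mult.assoc)
  also have "\<dots> = (\<Sum>u\<in>?K. if mset u = mset w
      then ?a w * (of_real (\<rho> ^ length w) * of_nat (N ^ CARD('n))) else 0)"
  proof (intro sum.cong refl)
    fix u assume u: "u \<in> ?K"
    show "?a u * (\<Sum>g\<in>G. (\<Prod>i\<leftarrow>u. X g $ i) * (\<Prod>i\<in>UNIV. cnj (\<omega> ^ g i) ^ count (mset w) i))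
        = (if mset u = mset w then ?a w * (of_real (\<rho> ^ length w) * of_nat (N ^ CARD('n))) else 0)"
      unfolding average[OF u] using symmetric_algebra_lookup_mset[OF a, of u w] by simp
  qed
  also have "\<dots> = of_nat (card ?E) * (?a w * (of_real (\<rho> ^ length w) * of_nat (N ^ CARD('n))))"
    by (simp add: sum.If_cases Int_def)
  finally have coefficient: "cmod (\<Sum>g\<in>G. F g)
      = card ?E * (cmod (?a w) * \<rho> ^ length w * N ^ CARD('n))"
    using \<rho> by (simp add: norm_mult norm_power)
  have "cmod (\<Sum>g\<in>G. F g) \<le> of_nat (card G) * M"
  proof (rule sum_norm_bound)
    fix g
    have "cmod (F g) = cmod (polynomial_of a (X g))"
      by (simp add: F_def norm_mult norm_power norm_\<omega> flip: prod_norm)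
    also have "\<dots> \<le> M"
      using \<rho> by (intro M) (simp add: X_def norm_mult norm_power norm_\<omega>)
    finally show "cmod (F g) \<le> M" .
  qed
  then have le: "card ?E * (cmod (?a w) * \<rho> ^ length w * N ^ CARD('n)) \<le> M * N ^ CARD('n)"
    by (simp add: coefficient card_G mult.commute)
  show ?thesis
  proof (cases "w \<in> ?K")
    case False
    have "0 \<le> cmod (polynomial_of a (\<chi> i. of_real \<rho>))" by simp
    also have "\<dots> \<le> M" using \<rho> by (intro M) simp
    finally show ?thesis using False by (simp add: in_keys_iff)
  next
    case True
    then have "card ?E \<ge> 1" by (auto simp: Suc_le_eq card_gt_0_iff)
    then have "1 * (cmod (?a w) * \<rho> ^ length w * N ^ CARD('n))
        \<le> card ?E * (cmod (?a w) * \<rho> ^ length w * N ^ CARD('n))"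
      using \<rho> by (intro mult_right_mono) auto
    with le have "cmod (?a w) * \<rho> ^ length w * N ^ CARD('n) \<le> M * N ^ CARD('n)" by linarith
    then show ?thesis using N by simp
  qed
qed

section \<open>The weighted seminorms are controlled by growth\<close>

text \<open>The radius \<open>\<rho>\<close> is where \<open>\<rho>\<^sup>-\<^sup>n exp (S \<rho>\<^sup>p)\<close> attains its minimum.  There \<open>exp (S \<rho>\<^sup>p)\<close> equals
  \<open>e\<^sup>n\<^sup>/\<^sup>p\<close>, and \<open>n! \<le> n\<^sup>n\<close> turns the factorial into a power of \<open>\<rho>\<close> as well.\<close>

lemma fact_powr_mult_optimal_cauchy_bound:
  fixes p S :: real
  assumes p: "p > 0" and S: "S > 0" and n: "n > 0"
  defines "\<rho> \<equiv> (n / (p * S)) powr (1 / p)"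
  shows "fact n powr (1 / p) * exp (S * \<rho> powr p) \<le> (\<rho> * (p * S * exp 1) powr (1 / p)) ^ n"
proof -
  have "\<rho> powr p = n / (p * S)" using p S n by (simp add: \<rho>_def powr_powr)
  then have "exp (S * \<rho> powr p) = (exp 1 ^ n) powr (1 / p)"
    using S p by (simp add: powr_def field_simps flip: exp_of_nat_mult)
  then have "fact n powr (1 / p) * exp (S * \<rho> powr p) = (fact n * exp 1 ^ n) powr (1 / p)"
    by (simp add: powr_mult)
  also have "\<dots> \<le> (real n ^ n * exp 1 ^ n) powr (1 / p)"
    using p fact_le_power[of n, where ?'a = real] by (intro powr_mono2 mult_right_mono) auto
  also have "\<dots> = ((n * exp 1) powr (1 / p)) ^ n"
    using n by (simp add: power_powr_commute flip: power_mult_distrib)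
  also have "(n * exp 1) powr (1 / p) = \<rho> * (p * S * exp 1) powr (1 / p)"
    unfolding \<rho>_def using p S n by (subst powr_mult[symmetric]) (auto simp: field_simps)
  finally show ?thesis .
qed

text \<open>Each degree contributes a Cauchy estimate at its own optimal radius.  Shrinking \<open>s\<close> makes these
  contributions decay as \<open>2\<^sup>-\<^sup>n\<close>, and the constant \<open>2\<close> is the sum of that series.\<close>

lemma weighted_seminorm_le_growth:
  fixes q :: "complex^'n::finite \<Rightarrow> real" and p :: real
  assumes q: "complex_seminorm q" and p: "p > 0"
  obtains s where "s > 0"
    "\<And>a. a \<in> symmetric_algebra \<Longrightarrow> weighted_seminorm (1 / p) q a \<le> 2 * growth_norm p s a"
proof -
  define m where "m = real CARD('n)"
  have m: "m > 0" by (simp add: m_def)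
  \<comment> \<open>The summand \<open>1\<close> keeps \<open>c\<close> positive when \<open>q\<close> vanishes identically.\<close>
  define c where "c = 1 + (\<Sum>i\<in>UNIV. q (axis i 1))"
  have c: "c > 0"
    using sum_nonneg[of UNIV "\<lambda>i. q (axis i 1)"] complex_seminorm_nonneg[OF q] by (simp add: c_def)
  have qc: "q (axis i 1) \<le> c" for i
    using member_le_sum[of i UNIV "\<lambda>i. q (axis i 1)"] complex_seminorm_nonneg[OF q] by (simp add: c_def)
  \<comment> \<open>\<open>S\<close> makes the ratio of the geometric series below equal to \<open>1 / 2\<close>, and \<open>s\<close> allows for
    \<open>|x| \<le> m \<rho>\<close> on the torus of radius \<open>\<rho>\<close>.\<close>
  define S where "S = (1 / (2 * c * m)) powr p / (p * exp 1)"
  have S: "S > 0" using c m p by (simp add: S_def)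
  have half: "c * m * (p * S * exp 1) powr (1 / p) = 1 / 2"
    using c m p by (simp add: S_def powr_powr)
  define s where "s = S / m powr p"
  have s: "s > 0" using S m by (simp add: s_def)
  have bound: "weighted_seminorm (1 / p) q a \<le> 2 * growth_norm p s a"
    if a: "a \<in> symmetric_algebra" for a
  proof -
    let ?g = "growth_norm p s a"
    have g: "?g \<ge> 0"
      using growth_norm_upper[OF p s, of a 0] by (rule order_trans[rotated]) simp
    have torus: "cmod (polynomial_of a x) \<le> ?g * exp (S * \<rho> powr p)"
      if x: "\<And>i. cmod (x $ i) = \<rho>" and \<rho>: "\<rho> > 0" for x \<rho>
    proof -
      have "norm x \<le> m * \<rho>"
        using L2_set_le_sum[of UNIV "\<lambda>i. cmod (x $ i)"] x \<rho> by (simp add: norm_vec_def m_def)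
      then have "norm x powr p \<le> m powr p * \<rho> powr p"
        using powr_mono2[of p "norm x" "m * \<rho>"] p m \<rho> by (simp add: powr_mult)
      then have "s * norm x powr p \<le> S * \<rho> powr p"
        using mult_left_mono[of _ _ s] s m by (fastforce simp: s_def)
      have "cmod (polynomial_of a x) \<le> ?g * exp (s * norm x powr p)"
        using growth_norm_upper[OF p s, of a x] by (simp add: exp_minus divide_simps)
      also have "\<dots> \<le> ?g * exp (S * \<rho> powr p)"
        using g \<open>s * norm x powr p \<le> S * \<rho> powr p\<close> by (intro mult_left_mono) auto
      finally show ?thesis .
    qed
    have degree_bound: "projective_seminorm q n (component n a) * fact n powr (1 / p) \<le> ?g * (1 / 2) ^ n" for n
    proof (cases "n = 0")
      case True
      have "polynomial_of a 0 = Poly_Mapping.lookup a []"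
      proof -
        have "polynomial_of a 0 = (\<Sum>w\<in>insert [] (Poly_Mapping.keys a).
            Poly_Mapping.lookup a w * (\<Prod>i\<leftarrow>w. (0 :: complex^'n) $ i))"
          by (rule polynomial_of_superset) auto
        also have "\<dots> = (\<Sum>w\<in>{[]}. Poly_Mapping.lookup a w * (\<Prod>i\<leftarrow>w. (0 :: complex^'n) $ i))"
          by (rule sum.mono_neutral_right) (auto simp: neq_Nil_conv)
        finally show ?thesis by simp
      qed
      then show ?thesis
        using growth_norm_upper[OF p s, of a 0] True
        by (simp add: projective_seminorm_def lookup_component)
    next
      case False
      then have n: "n > 0" by simp
      define \<rho> where "\<rho> = (n / (p * S)) powr (1 / p)"
      have \<rho>: "\<rho> > 0" using n p S by (simp add: \<rho>_def)
      let ?M = "?g * exp (S * \<rho> powr p)"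
      let ?t = "component n a"
      let ?W = "{w :: 'n list. set w \<subseteq> UNIV \<and> length w = n}"
      have finW: "finite ?W" and cardW: "card ?W = CARD('n) ^ n"
        by (rule finite_lists_length_eq card_lists_length_eq, simp)+
      have coeff: "cmod (Poly_Mapping.lookup ?t w) \<le> ?M / \<rho> ^ n" if "w \<in> ?W" for w
        using cauchy_estimate[OF a \<rho> torus[OF _ \<rho>], of w] \<rho> that
        by (simp add: lookup_component pos_le_divide_eq)
      have "projective_seminorm q n ?t
          \<le> c ^ n * (\<Sum>w\<in>Poly_Mapping.keys ?t. cmod (Poly_Mapping.lookup ?t w))"
        by (rule projective_seminorm_le_coefficients(1)[OF q component_in_tensor_power qc])
      also have "(\<Sum>w\<in>Poly_Mapping.keys ?t. cmod (Poly_Mapping.lookup ?t w))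
          \<le> (\<Sum>w\<in>?W. cmod (Poly_Mapping.lookup ?t w))"
        using component_in_tensor_power[of n a] finW
        by (intro sum_mono2) (auto simp: tensor_power_def)
      also have "\<dots> \<le> of_nat (card ?W) * (?M / \<rho> ^ n)"
        by (rule sum_bounded_above) (rule coeff)
      finally have "projective_seminorm q n ?t \<le> c ^ n * (m ^ n * (?M / \<rho> ^ n))"
        using c unfolding cardW by (simp add: m_def)
      then have "projective_seminorm q n ?t * fact n powr (1 / p)
          \<le> (c ^ n * (m ^ n * (?M / \<rho> ^ n))) * fact n powr (1 / p)"
        by (intro mult_right_mono) auto
      also have "\<dots> = ?g * (c * m / \<rho>) ^ n * (fact n powr (1 / p) * exp (S * \<rho> powr p))"
        by (simp add: power_mult_distrib power_divide)
      also have "\<dots> \<le> ?g * (c * m / \<rho>) ^ n * (\<rho> * (p * S * exp 1) powr (1 / p)) ^ n"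
        using g c m \<rho> unfolding \<rho>_def
        by (intro mult_left_mono fact_powr_mult_optimal_cauchy_bound p S n) auto
      also have "\<dots> = ?g * (c * m * (p * S * exp 1) powr (1 / p)) ^ n"
        using \<rho> by (simp add: power_mult_distrib power_divide)
      finally show ?thesis by (simp add: half)
    qed
    obtain N where N: "\<forall>n>N. component n a = 0" using component_eventually_zero by blast
    have "weighted_seminorm (1 / p) q a \<le> (\<Sum>n\<le>N. ?g * (1 / 2) ^ n)"
      unfolding weighted_seminorm_eq_sum[OF q N] by (rule sum_mono) (rule degree_bound)
    also have "\<dots> = ?g * (\<Sum>n\<le>N. (1 / 2) ^ n)" by (simp add: sum_distrib_left)
    also have "\<dots> \<le> ?g * 2"
      using sum_le_suminf[of "\<lambda>n. (1 / 2 :: real) ^ n" "{..N}"] g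
      by (intro mult_left_mono) (auto simp: suminf_geometric)
    finally show ?thesis by (simp add: mult.commute)
  qed
  show ?thesis using that[OF s] bound by blast
qed


section \<open>Equality of the topologies\<close>

theorem proposition5p15:
  fixes d :: nat and p :: real
  assumes "CARD('n::finite) = 2 * d" and "0 < p" and "p \<le> 2"
  shows "seminorm_topology (symmetric_algebra :: 'n tensor set) {growth_norm p s | s. s > 0}
       = seminorm_topology symmetric_algebra {weighted_seminorm (1 / p) q | q. complex_seminorm q}"
proof -
  let ?S = "symmetric_algebra :: 'n tensor set"
  let ?G = "{growth_norm p s :: 'n tensor \<Rightarrow> real | s. s > 0}"
  let ?W = "{weighted_seminorm (1 / p) q :: 'n tensor \<Rightarrow> real | q. complex_seminorm q}"
  note p = \<open>0 < p\<close>
  have G_le_W: "\<exists>q'\<in>?W. \<exists>C>0. \<forall>a\<in>?S. g a \<le> C * q' a" if g: "g \<in> ?G" for g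
  proof -
    obtain s where s: "g = growth_norm p s" "s > 0" using g by auto
    let ?q = "\<lambda>v :: complex^'n. (p * s) powr (- (1 / p)) * norm v"
    have "weighted_seminorm (1 / p) ?q \<in> ?W"
      by (intro CollectI exI[of _ ?q] conjI refl complex_seminorm_scaled_norm) simp
    moreover have "\<forall>a\<in>?S. g a \<le> 1 * weighted_seminorm (1 / p) ?q a"
      unfolding s(1) using p s(2) by (simp add: growth_norm_le_weighted)
    ultimately show ?thesis using zero_less_one by blast
  qed
  have W_le_G: "\<exists>g\<in>?G. \<exists>C>0. \<forall>a\<in>?S. w a \<le> C * g a" if w: "w \<in> ?W" for w
  proof -
    obtain q where q: "w = weighted_seminorm (1 / p) q" "complex_seminorm q" using w by auto
    obtain s where "s > 0" "\<And>a. a \<in> ?S \<Longrightarrow> w a \<le> 2 * growth_norm p s a"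
      using weighted_seminorm_le_growth[OF q(2) p] q(1) by blast
    moreover have "(0::real) < 2" by simp
    ultimately show ?thesis by blast
  qed
  have G: "g (a + b) \<le> g a + g b" "g 0 = 0" if "g \<in> ?G" for g a b
    using that by (auto simp: growth_norm_zero growth_norm_add p)
  have W: "w (a + b) \<le> w a + w b" "w 0 = 0" if "w \<in> ?W" for w a b
    using that by (auto simp: weighted_seminorm_zero weighted_seminorm_add)
  show ?thesis
  proof (rule topology_eq[THEN iffD2], intro allI iffI)
    fix U
    show "openin (seminorm_topology ?S ?W) U" if "openin (seminorm_topology ?S ?G) U"
      by (rule openin_seminorm_topology_mono[where P = ?G])
         (fact symmetric_algebra_diff G(1) W(2) G_le_W that)+
    show "openin (seminorm_topology ?S ?G) U" if "openin (seminorm_topology ?S ?W) U"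
      by (rule openin_seminorm_topology_mono[where P = ?W])
         (fact symmetric_algebra_diff W(1) G(2) W_le_G that)+
  qed
qed

end
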